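(* Let $\hat v\in C^1([t_0,t_{\rm end}],\mathbb{R}^{mn})$ be the solution of an initial value problem of the stochastic Galerkin system $$\hat E\,\dot{\hat v}(t)=\hat A\hat v(t)+\hat F(\hat v(t))+\hat B u(t),\qquad \hat w(t)=\hat C\hat v(t),$$ and let $\hat y(t,p)=\sum_{i=1}^m \hat w_i(t)\Phi_i(p)$ be the associated quantity of interest. Let $t_0<t_1<\dots<t_{\ell-1}=t_{\rm end}$ be the snapshot times, let $\ell>r$, let $\sigma_1\ge\dots\ge\sigma_\ell\ge 0$ be the singular values of the snapshot matrix $V=(\hat v(t_0),\hat v(t_1),\ldots,\hat v(t_{\ell-1}))$, and let $T_{\rm r}\in\mathbb{R}^{mn\times r}$ be the POD projection matrix of dimension $r$ obtained from $V$. Put $\bar C=\hat C T_{\rm r}=(\bar c_{ij})\in\mathbb{R}^{m\times r}$ and $\Psi_j=\sum_{i=1}^m \bar c_{ij}\Phi_i$ for $j=1,\ldots,r$. For each $t$ let $y^*(t,\cdot)=\sum_{j=1}^r w_j^*(t)\Psi_j$ be the best approximation of $\hat y(t,\cdot)$ in $\mathrm{span}\{\Psi_1,\ldots,\Psi_r\}$ with respect to $\|\cdot\|_{\mathcal{L}^2(\Pi,\rho)}$. Then for each $t\in[t_0,t_{\rm end}]$ $$\left\|\hat y(t,\cdot)-y^*(t,\cdot)\right\|_{\mathcal{L}^2(\Pi,\rho)}\le \|\hat C\|_2\left(\sigma_{r+1}+\sqrt{mn}\;\Delta t\max_{t_0\le\tau\le t_{\rm end}}\left\|\dot{\hat v}(\tau)\right\|_\infty\right),$$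 where $\Delta t=\max\{t_j-t_{j-1}: j=1,\ldots,\ell-1\}$.
   Context: Setting. $\Pi\subseteq\mathbb{R}^q$ is a parameter domain with probability density $\rho:\Pi\to\mathbb{R}$, $\mathbb{E}[f]=\int_\Pi f(p)\rho(p)\,dp$ (componentwise for arrays). $\mathcal{L}^2(\Pi,\rho)$ is the Hilbert space of measurable $f:\Pi\to\mathbb{R}$ with $\mathbb{E}[f^2]<\infty$, with inner product $\langle f,g\rangle=\mathbb{E}[fg]$. $(\Phi_i)_{i\in\mathbb{N}}$ is a complete orthonormal system in $\mathcal{L}^2(\Pi,\rho)$ with $\Phi_1\equiv 1$; $m\ge 1$ is a fixed truncation index. The underlying parametric system is $E(p)\dot x=A(p)x+F(x,p)+B(p)u(t)$, $y=C(p)x$, with $A(p),E(p)\in\mathbb{R}^{n\times n}$, $B(p)\in\mathbb{R}^{n\times 1}$, $C(p)\in\mathbb{R}^{1\times n}$, $F:\mathbb{R}^n\times\Pi\to\mathbb{R}^n$, scalar input $u$ ($E(p)$ may be singular). Stochastic Galerkin system. With $S(p)=(\Phi_i(p)\Phi_j(p))_{i,j=1}^m\in\mathbb{R}^{m\times m}$ and $s(p)=(\Phi_i(p))_{i=1}^m\in\mathbb{R}^m$, set $\hat A=\mathbb{E}[S\otimes A]$, $\hat E=\mathbb{E}[S\otimes E]\in\mathbb{R}^{mn\times mn}$, $\hat B=\mathbb{E}[s\otimes B]\in\mathbb{R}^{mn}$, $\hat C=\mathbb{E}[S\otimes C]\in\mathbb{R}^{m\times mn}$, and $\hat F=(\hat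 F_1^\top,\ldots,\hat F_m^\top)^\top$ with $\hat F_i(\hat v)=\mathbb{E}\big[F\big(\sum_{j=1}^m\hat v_j\Phi_j(\cdot),\cdot\big)\Phi_i(\cdot)\big]\in\mathbb{R}^n$ for $\hat v=(\hat v_1^\top,\ldots,\hat v_m^\top)^\top$, $\hat v_j\in\mathbb{R}^n$ (all these expectations are assumed to exist). The output is $\hat w=(\hat w_1,\ldots,\hat w_m)^\top\in\mathbb{R}^m$. POD projection matrix. Let $V=U\begin{pmatrix}\Sigma\\0\end{pmatrix}Q^\top$ be a singular value decomposition of the snapshot matrix $V\in\mathbb{R}^{mn\times\ell}$ (with $\ell\le mn$), where $U\in\mathbb{R}^{mn\times mn}$, $Q\in\mathbb{R}^{\ell\times\ell}$ are orthogonal and $\Sigma=\mathrm{diag}(\sigma_1,\ldots,\sigma_\ell)$ with $\sigma_1\ge\dots\ge\sigma_\ell\ge0$. Then $T_{\rm r}=(u_1,\ldots,u_r)$ consists of the first $r$ columns of $U$. Best approximation. For each $t$, $w^*(t)=(w_1^*(t),\ldots,w_r^*(t))^\top\in\mathbb{R}^r$ is a minimiser of $\|\hat y(t,\cdot)-\sum_{j=1}^r w_j\Psi_j\|_{\mathcal{L}^2(\Pi,\rho)}$ over $w\in\mathbb{R}^r$. Norms: $\|\cdot\|_2$ is the Euclidean/spectral norm, $\|\cdot\|_\infty$ the maximum norm of vectors. *)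

theory Defs
  imports "HOL-Analysis.Analysis" "Jordan_Normal_Form.Matrix"
begin

text \<open>Vectors and matrices are those of Jordan_Normal_Form, whose dimensions are ordinary natural
  numbers, not the type-indexed ones of HOL-Analysis.\<close>

unbundle no vec_syntax

text \<open>All indices start at 0. In particular the basis function \<open>\<Phi>\<^sub>1 = 1\<close> of the one-based
  notation is \<open>\<Phi> 0\<close>, and the singular value \<open>\<sigma>\<^sub>r\<^sub>+\<^sub>1\<close> is \<open>\<sigma> r\<close>.\<close>


section \<open>Norms, Kronecker product, expectation\<close>

definition norm2_vec :: "real vec \<Rightarrow> real" where
  "norm2_vec x = sqrt (x \<bullet> x)"

text \<open>Only used for vectors of positive dimension.\<close>

definition norminf_vec :: "real vec \<Rightarrow> real" where
  "norminf_vec x = Max ((\<lambda>i. \<bar>x $ i\<bar>) ` {..<dim_vec x})"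

definition norm2_mat :: "real mat \<Rightarrow> real" where
  "norm2_mat M = (SUP x \<in> {x \<in> carrier_vec (dim_col M). norm2_vec x \<le> 1}. norm2_vec (M *\<^sub>v x))"

definition kronecker :: "real mat \<Rightarrow> real mat \<Rightarrow> real mat" (infixl \<open>\<otimes>\<^sub>k\<close> 70) where
  "M \<otimes>\<^sub>k N = mat (dim_row M * dim_row N) (dim_col M * dim_col N)
     (\<lambda>(i, j). M $$ (i div dim_row N, j div dim_col N) * N $$ (i mod dim_row N, j mod dim_col N))"

definition is_prob_density :: "'q::euclidean_space set \<Rightarrow> ('q \<Rightarrow> real) \<Rightarrow> bool" where
  "is_prob_density P \<rho> \<longleftrightarrow>
     P \<in> sets lebesgue \<and> (\<forall>p\<in>P. 0 \<le> \<rho> p) \<and> has_bochner_integral (lebesgue_on P) \<rho> 1"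

definition expectation :: "'q::euclidean_space set \<Rightarrow> ('q \<Rightarrow> real) \<Rightarrow> ('q \<Rightarrow> real) \<Rightarrow> real" where
  "expectation P \<rho> f = (\<integral>p. f p * \<rho> p \<partial>(lebesgue_on P))"

definition expectation_exists :: "'q::euclidean_space set \<Rightarrow> ('q \<Rightarrow> real) \<Rightarrow> ('q \<Rightarrow> real) \<Rightarrow> bool" where
  "expectation_exists P \<rho> f \<longleftrightarrow> integrable (lebesgue_on P) (\<lambda>p. f p * \<rho> p)"

text \<open>Componentwise expectation of a random matrix with \<open>k\<close> rows and \<open>l\<close> columns.\<close>

definition expectation_mat ::
  "'q::euclidean_space set \<Rightarrow> ('q \<Rightarrow> real) \<Rightarrow> nat \<Rightarrow> nat \<Rightarrow> ('q \<Rightarrow> real mat) \<Rightarrow> real mat" where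
  "expectation_mat P \<rho> k l M = mat k l (\<lambda>(i, j). expectation P \<rho> (\<lambda>p. M p $$ (i, j)))"

definition expectation_mat_exists ::
  "'q::euclidean_space set \<Rightarrow> ('q \<Rightarrow> real) \<Rightarrow> nat \<Rightarrow> nat \<Rightarrow> ('q \<Rightarrow> real mat) \<Rightarrow> bool" where
  "expectation_mat_exists P \<rho> k l M \<longleftrightarrow>
     (\<forall>i<k. \<forall>j<l. expectation_exists P \<rho> (\<lambda>p. M p $$ (i, j)))"


section \<open>The space \<open>L\<^sup>2(\<Pi>, \<rho>)\<close>\<close>

text \<open>Functions are not identified when they agree almost everywhere.\<close>

definition L2_fun :: "'q::euclidean_space set \<Rightarrow> ('q \<Rightarrow> real) \<Rightarrow> ('q \<Rightarrow> real) set" where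
  "L2_fun P \<rho> =
     {f \<in> borel_measurable (lebesgue_on P). expectation_exists P \<rho> (\<lambda>p. (f p)\<^sup>2)}"

definition L2_inner ::
  "'q::euclidean_space set \<Rightarrow> ('q \<Rightarrow> real) \<Rightarrow> ('q \<Rightarrow> real) \<Rightarrow> ('q \<Rightarrow> real) \<Rightarrow> real" where
  "L2_inner P \<rho> f g = expectation P \<rho> (\<lambda>p. f p * g p)"

definition L2_norm :: "'q::euclidean_space set \<Rightarrow> ('q \<Rightarrow> real) \<Rightarrow> ('q \<Rightarrow> real) \<Rightarrow> real" where
  "L2_norm P \<rho> f = sqrt (L2_inner P \<rho> f f)"

text \<open>Completeness: the finite linear combinations are dense.\<close>

definition complete_orthonormal_system ::
  "'q::euclidean_space set \<Rightarrow> ('q \<Rightarrow> real) \<Rightarrow> (nat \<Rightarrow> 'q \<Rightarrow> real) \<Rightarrow> bool" where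
  "complete_orthonormal_system P \<rho> \<Phi> \<longleftrightarrow>
     (\<forall>i. \<Phi> i \<in> L2_fun P \<rho>) \<and>
     (\<forall>i j. L2_inner P \<rho> (\<Phi> i) (\<Phi> j) = (if i = j then 1 else 0)) \<and>
     (\<forall>f \<in> L2_fun P \<rho>. \<forall>\<epsilon>>0. \<exists>N c. L2_norm P \<rho> (\<lambda>p. f p - (\<Sum>i<N. c i * \<Phi> i p)) < \<epsilon>)"


section \<open>The stochastic Galerkin system\<close>

definition parametric_system ::
  "'q::euclidean_space set \<Rightarrow> nat \<Rightarrow> ('q \<Rightarrow> real mat) \<Rightarrow> ('q \<Rightarrow> real mat) \<Rightarrow> ('q \<Rightarrow> real mat)
    \<Rightarrow> ('q \<Rightarrow> real mat) \<Rightarrow> (real vec \<Rightarrow> 'q \<Rightarrow> real vec) \<Rightarrow> bool" where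
  "parametric_system P n E A B C F \<longleftrightarrow>
     (\<forall>p\<in>P. E p \<in> carrier_mat n n \<and> A p \<in> carrier_mat n n \<and>
       B p \<in> carrier_mat n 1 \<and> C p \<in> carrier_mat 1 n \<and>
       (\<forall>x \<in> carrier_vec n. F x p \<in> carrier_vec n))"

definition S_mat :: "(nat \<Rightarrow> 'q \<Rightarrow> real) \<Rightarrow> nat \<Rightarrow> 'q \<Rightarrow> real mat" where
  "S_mat \<Phi> m p = mat m m (\<lambda>(i, j). \<Phi> i p * \<Phi> j p)"

text \<open>The vector \<open>s(p)\<close> as a one-column matrix.\<close>

definition s_col :: "(nat \<Rightarrow> 'q \<Rightarrow> real) \<Rightarrow> nat \<Rightarrow> 'q \<Rightarrow> real mat" where
  "s_col \<Phi> m p = mat m 1 (\<lambda>(i, j). \<Phi> i p)"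

text \<open>Used for both \<open>A\<close> and \<open>E\<close>.\<close>

definition sg_mat ::
  "'q::euclidean_space set \<Rightarrow> ('q \<Rightarrow> real) \<Rightarrow> (nat \<Rightarrow> 'q \<Rightarrow> real) \<Rightarrow> nat \<Rightarrow> nat
    \<Rightarrow> ('q \<Rightarrow> real mat) \<Rightarrow> real mat" where
  "sg_mat P \<rho> \<Phi> m n A = expectation_mat P \<rho> (m * n) (m * n) (\<lambda>p. S_mat \<Phi> m p \<otimes>\<^sub>k A p)"

definition sg_input ::
  "'q::euclidean_space set \<Rightarrow> ('q \<Rightarrow> real) \<Rightarrow> (nat \<Rightarrow> 'q \<Rightarrow> real) \<Rightarrow> nat \<Rightarrow> nat
    \<Rightarrow> ('q \<Rightarrow> real mat) \<Rightarrow> real vec" where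
  "sg_input P \<rho> \<Phi> m n B = col (expectation_mat P \<rho> (m * n) 1 (\<lambda>p. s_col \<Phi> m p \<otimes>\<^sub>k B p)) 0"

definition sg_output ::
  "'q::euclidean_space set \<Rightarrow> ('q \<Rightarrow> real) \<Rightarrow> (nat \<Rightarrow> 'q \<Rightarrow> real) \<Rightarrow> nat \<Rightarrow> nat
    \<Rightarrow> ('q \<Rightarrow> real mat) \<Rightarrow> real mat" where
  "sg_output P \<rho> \<Phi> m n C = expectation_mat P \<rho> m (m * n) (\<lambda>p. S_mat \<Phi> m p \<otimes>\<^sub>k C p)"

text \<open>The block \<open>v\<^sub>j\<close> of \<open>v\<close> has the entries \<open>v $ (j * n + k)\<close> with \<open>k < n\<close>.\<close>

definition sg_state :: "(nat \<Rightarrow> 'q \<Rightarrow> real) \<Rightarrow> nat \<Rightarrow> nat \<Rightarrow> real vec \<Rightarrow> 'q \<Rightarrow> real vec" where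
  "sg_state \<Phi> m n v p = vec n (\<lambda>k. \<Sum>j<m. v $ (j * n + k) * \<Phi> j p)"

definition sg_nonlin ::
  "'q::euclidean_space set \<Rightarrow> ('q \<Rightarrow> real) \<Rightarrow> (nat \<Rightarrow> 'q \<Rightarrow> real) \<Rightarrow> nat \<Rightarrow> nat
    \<Rightarrow> (real vec \<Rightarrow> 'q \<Rightarrow> real vec) \<Rightarrow> real vec \<Rightarrow> real vec" where
  "sg_nonlin P \<rho> \<Phi> m n F v = vec (m * n) (\<lambda>a.
     expectation P \<rho> (\<lambda>p. F (sg_state \<Phi> m n v p) p $ (a mod n) * \<Phi> (a div n) p))"

definition sg_well_defined ::
  "'q::euclidean_space set \<Rightarrow> ('q \<Rightarrow> real) \<Rightarrow> (nat \<Rightarrow> 'q \<Rightarrow> real) \<Rightarrow> nat \<Rightarrow> nat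
    \<Rightarrow> ('q \<Rightarrow> real mat) \<Rightarrow> ('q \<Rightarrow> real mat) \<Rightarrow> ('q \<Rightarrow> real mat) \<Rightarrow> ('q \<Rightarrow> real mat)
    \<Rightarrow> (real vec \<Rightarrow> 'q \<Rightarrow> real vec) \<Rightarrow> bool" where
  "sg_well_defined P \<rho> \<Phi> m n E A B C F \<longleftrightarrow>
     expectation_mat_exists P \<rho> (m * n) (m * n) (\<lambda>p. S_mat \<Phi> m p \<otimes>\<^sub>k E p) \<and>
     expectation_mat_exists P \<rho> (m * n) (m * n) (\<lambda>p. S_mat \<Phi> m p \<otimes>\<^sub>k A p) \<and>
     expectation_mat_exists P \<rho> (m * n) 1 (\<lambda>p. s_col \<Phi> m p \<otimes>\<^sub>k B p) \<and>
     expectation_mat_exists P \<rho> m (m * n) (\<lambda>p. S_mat \<Phi> m p \<otimes>\<^sub>k C p) \<and>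
     (\<forall>v \<in> carrier_vec (m * n). \<forall>i<m. \<forall>k<n.
        expectation_exists P \<rho> (\<lambda>p. F (sg_state \<Phi> m n v p) p $ k * \<Phi> i p))"

text \<open>\<open>v\<close> is continuously differentiable on \<open>[a, b]\<close> (one-sided at the end points) with
  derivative \<open>v'\<close>.\<close>

definition C1_with_deriv ::
  "nat \<Rightarrow> real \<Rightarrow> real \<Rightarrow> (real \<Rightarrow> real vec) \<Rightarrow> (real \<Rightarrow> real vec) \<Rightarrow> bool" where
  "C1_with_deriv d a b v v' \<longleftrightarrow>
     (\<forall>t\<in>{a..b}. v t \<in> carrier_vec d \<and> v' t \<in> carrier_vec d) \<and>
     (\<forall>i<d. (\<forall>t\<in>{a..b}. ((\<lambda>\<tau>. v \<tau> $ i) has_real_derivative v' t $ i) (at t within {a..b})) \<and>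
       continuous_on {a..b} (\<lambda>\<tau>. v' \<tau> $ i))"

text \<open>\<open>v\<close>, with derivative \<open>v'\<close>, solves the initial value problem with initial value \<open>v0\<close>.\<close>

definition sg_solution ::
  "'q::euclidean_space set \<Rightarrow> ('q \<Rightarrow> real) \<Rightarrow> (nat \<Rightarrow> 'q \<Rightarrow> real) \<Rightarrow> nat \<Rightarrow> nat
    \<Rightarrow> ('q \<Rightarrow> real mat) \<Rightarrow> ('q \<Rightarrow> real mat) \<Rightarrow> ('q \<Rightarrow> real mat)
    \<Rightarrow> (real vec \<Rightarrow> 'q \<Rightarrow> real vec) \<Rightarrow> (real \<Rightarrow> real)
    \<Rightarrow> real \<Rightarrow> real \<Rightarrow> real vec \<Rightarrow> (real \<Rightarrow> real vec) \<Rightarrow> (real \<Rightarrow> real vec) \<Rightarrow> bool" where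
  "sg_solution P \<rho> \<Phi> m n E A B F u t0 tend v0 v v' \<longleftrightarrow>
     C1_with_deriv (m * n) t0 tend v v' \<and>
     v t0 = v0 \<and>
     (\<forall>t\<in>{t0..tend}. sg_mat P \<rho> \<Phi> m n E *\<^sub>v v' t =
        sg_mat P \<rho> \<Phi> m n A *\<^sub>v v t + sg_nonlin P \<rho> \<Phi> m n F (v t)
          + u t \<cdot>\<^sub>v sg_input P \<rho> \<Phi> m n B)"


section \<open>Proper orthogonal decomposition\<close>

text \<open>The constant \<open>orthogonal_mat\<close> of Jordan_Normal_Form does not normalise the columns.\<close>

definition orthogonal_matrix :: "nat \<Rightarrow> real mat \<Rightarrow> bool" where
  "orthogonal_matrix d U \<longleftrightarrow>
     U \<in> carrier_mat d d \<and> transpose_mat U * U = 1\<^sub>m d \<and> U * transpose_mat U = 1\<^sub>m d"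

definition is_svd ::
  "nat \<Rightarrow> nat \<Rightarrow> real mat \<Rightarrow> real mat \<Rightarrow> (nat \<Rightarrow> real) \<Rightarrow> real mat \<Rightarrow> bool" where
  "is_svd d l V U \<sigma> Q \<longleftrightarrow>
     orthogonal_matrix d U \<and> orthogonal_matrix l Q \<and>
     (\<forall>i j. i \<le> j \<and> j < l \<longrightarrow> \<sigma> j \<le> \<sigma> i) \<and> (\<forall>i<l. 0 \<le> \<sigma> i) \<and>
     V = U * mat d l (\<lambda>(i, j). if i = j then \<sigma> i else 0) * transpose_mat Q"

definition snapshot_mat :: "nat \<Rightarrow> nat \<Rightarrow> (real \<Rightarrow> real vec) \<Rightarrow> (nat \<Rightarrow> real) \<Rightarrow> real mat" where
  "snapshot_mat d l v ts = mat_of_cols d (map (\<lambda>j. v (ts j)) [0..<l])"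

definition pod_mat :: "nat \<Rightarrow> real mat \<Rightarrow> nat \<Rightarrow> real mat" where
  "pod_mat d U r = mat_of_cols d (map (col U) [0..<r])"

text \<open>\<open>basis_comb \<Phi> c\<close> is the linear combination of the first \<open>dim_vec c\<close> functions.\<close>

definition basis_comb :: "(nat \<Rightarrow> 'q \<Rightarrow> real) \<Rightarrow> real vec \<Rightarrow> 'q \<Rightarrow> real" where
  "basis_comb \<Phi> c p = (\<Sum>i<dim_vec c. c $ i * \<Phi> i p)"

definition is_best_approx ::
  "'q::euclidean_space set \<Rightarrow> ('q \<Rightarrow> real) \<Rightarrow> nat \<Rightarrow> (nat \<Rightarrow> 'q \<Rightarrow> real) \<Rightarrow> ('q \<Rightarrow> real)
    \<Rightarrow> real vec \<Rightarrow> bool" where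
  "is_best_approx P \<rho> r \<Psi> y w \<longleftrightarrow>
     w \<in> carrier_vec r \<and>
     (\<forall>w' \<in> carrier_vec r. L2_norm P \<rho> (\<lambda>p. y p - basis_comb \<Psi> w p)
        \<le> L2_norm P \<rho> (\<lambda>p. y p - basis_comb \<Psi> w' p))"

end

theory Submission
  imports Defs
begin

text \<open>The best approximation is at least as good as the competitor with coefficients
  \<open>T\<^sub>r\<^sup>T v(t\<^sub>j)\<close>, where \<open>t\<^sub>j\<close> is the last snapshot time before \<open>t\<close>.
  By orthonormality (Parseval) its error is the Euclidean norm of
  \<open>C (v(t) - T\<^sub>r T\<^sub>r\<^sup>T v(t\<^sub>j))\<close>. Split the argument of \<open>C\<close> at \<open>v(t\<^sub>j)\<close>: the increment
  \<open>v(t) - v(t\<^sub>j)\<close> is controlled by the mean value theorem in each component, and the projection error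
  of the snapshot \<open>v(t\<^sub>j)\<close> by its coordinates in the basis of left singular vectors.\<close>

section \<open>Euclidean and spectral norm\<close>

lemma norm2_vec_eq_L2_set: "norm2_vec x = L2_set (\<lambda>i. x $ i) {..<dim_vec x}"
  by (simp add: norm2_vec_def L2_set_def scalar_prod_def power2_eq_square atLeast0LessThan)

lemma norm2_vec_nonneg: "0 \<le> norm2_vec x"
  by (simp add: norm2_vec_eq_L2_set)

lemma norm2_vec_smult: "norm2_vec (a \<cdot>\<^sub>v x) = \<bar>a\<bar> * norm2_vec x"
proof -
  have "(a \<cdot>\<^sub>v x) \<bullet> (a \<cdot>\<^sub>v x) = a\<^sup>2 * (x \<bullet> x)"
    by (simp add: scalar_prod_def sum_distrib_left power2_eq_square mult_ac)
  then show ?thesis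
    by (simp add: norm2_vec_def real_sqrt_mult)
qed

lemma norm2_vec_add_le:
  assumes "dim_vec x = dim_vec y"
  shows "norm2_vec (x + y) \<le> norm2_vec x + norm2_vec y"
proof -
  have "norm2_vec (x + y) = L2_set (\<lambda>i. x $ i + y $ i) {..<dim_vec y}"
    by (simp add: norm2_vec_eq_L2_set cong: L2_set_cong_simp)
  also have "\<dots> \<le> norm2_vec x + norm2_vec y"
    using L2_set_triangle_ineq by (simp add: norm2_vec_eq_L2_set assms)
  finally show ?thesis .
qed

lemma norm2_vec_mono:
  assumes "dim_vec x = dim_vec y" and "\<And>i. i < dim_vec x \<Longrightarrow> \<bar>x $ i\<bar> \<le> \<bar>y $ i\<bar>"
  shows "norm2_vec x \<le> norm2_vec y"
  unfolding norm2_vec_eq_L2_set L2_set_def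
  using assms by (auto intro!: sum_mono simp: abs_le_square_iff)

text \<open>Comparison with the constant vector of entry \<open>K\<close>. This is the source of the
  factor \<open>sqrt (real (m * n))\<close> in the final bound.\<close>

lemma norm2_vec_le_sqrt_dim:
  assumes "\<And>i. i < dim_vec x \<Longrightarrow> \<bar>x $ i\<bar> \<le> K" and "0 \<le> K"
  shows "norm2_vec x \<le> sqrt (real (dim_vec x)) * K"
proof -
  have "norm2_vec x \<le> norm2_vec (vec (dim_vec x) (\<lambda>_. K))"
    using assms by (intro norm2_vec_mono) auto
  also have "\<dots> = sqrt (real (dim_vec x)) * K"
    using assms(2)
    by (simp add: norm2_vec_eq_L2_set L2_set_def real_sqrt_mult)
  finally show ?thesis .
qed

text \<open>Cauchy-Schwarz in each row; the \<open>L2_set\<close> of the row norms is the Frobenius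
  norm. It serves to show that the supremum defining \<open>norm2_mat\<close> is finite.\<close>

lemma norm2_mult_mat_vec_le_Frobenius:
  assumes "dim_vec x = dim_col M"
  shows "norm2_vec (M *\<^sub>v x) \<le> L2_set (\<lambda>i. norm2_vec (row M i)) {..<dim_row M} * norm2_vec x"
proof -
  have entry: "\<bar>(M *\<^sub>v x) $ i\<bar> \<le> norm2_vec (row M i) * norm2_vec x" if "i < dim_row M" for i
  proof -
    have "\<bar>(M *\<^sub>v x) $ i\<bar> \<le> (\<Sum>j<dim_vec x. \<bar>row M i $ j\<bar> * \<bar>x $ j\<bar>)"
      using that by (auto simp: scalar_prod_def atLeast0LessThan abs_mult intro!: order_trans[OF sum_abs])
    also have "\<dots> \<le> norm2_vec (row M i) * norm2_vec x"
      using L2_set_mult_ineq by (simp add: norm2_vec_eq_L2_set assms)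
    finally show ?thesis .
  qed
  have "norm2_vec (M *\<^sub>v x) \<le> norm2_vec (norm2_vec x \<cdot>\<^sub>v vec (dim_row M) (\<lambda>i. norm2_vec (row M i)))"
    using entry by (intro norm2_vec_mono) (auto simp: norm2_vec_nonneg mult.commute)
  also have "\<dots> = L2_set (\<lambda>i. norm2_vec (row M i)) {..<dim_row M} * norm2_vec x"
    by (simp add: norm2_vec_smult norm2_vec_nonneg norm2_vec_eq_L2_set[of "vec _ _"] cong: L2_set_cong_simp)
  finally show ?thesis .
qed

text \<open>A supremum of reals can be compared with its members only once the set is known to be
  bounded; the Frobenius norm is the bound.\<close>

lemma bdd_above_norm2_mat:
  "bdd_above ((\<lambda>x. norm2_vec (M *\<^sub>v x)) ` {x \<in> carrier_vec (dim_col M). norm2_vec x \<le> 1})"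
proof (rule bdd_aboveI2)
  fix x assume x: "x \<in> {x \<in> carrier_vec (dim_col M). norm2_vec x \<le> 1}"
  let ?K = "L2_set (\<lambda>i. norm2_vec (row M i)) {..<dim_row M}"
  have "norm2_vec (M *\<^sub>v x) \<le> ?K * norm2_vec x"
    using x by (intro norm2_mult_mat_vec_le_Frobenius) auto
  also have "\<dots> \<le> ?K * 1"
    using x by (intro mult_left_mono) auto
  finally show "norm2_vec (M *\<^sub>v x) \<le> ?K" by simp
qed

lemma norm2_mat_nonneg: "0 \<le> norm2_mat M"
proof -
  have "norm2_vec (M *\<^sub>v 0\<^sub>v (dim_col M)) \<le> norm2_mat M"
    unfolding norm2_mat_def
    by (rule cSUP_upper[OF _ bdd_above_norm2_mat]) (simp add: norm2_vec_def)
  then show ?thesis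
    using norm2_vec_nonneg order_trans by blast
qed

text \<open>By homogeneity: dividing \<open>x\<close> by its norm gives a member of the unit ball
  over which \<open>norm2_mat\<close> takes its supremum.\<close>

lemma norm2_mult_mat_vec_le:
  assumes "x \<in> carrier_vec (dim_col M)"
  shows "norm2_vec (M *\<^sub>v x) \<le> norm2_mat M * norm2_vec x"
proof (cases "norm2_vec x = 0")
  case True
  \<comment> \<open>A vector of norm zero cannot be normalised; here the Frobenius bound forces the
    left side to vanish.\<close>
  then show ?thesis
    using norm2_mult_mat_vec_le_Frobenius[of x M] assms by simp
next
  case False
  define c where "c = norm2_vec x"
  have c: "c > 0"
    using False norm2_vec_nonneg[of x] by (simp add: c_def)
  have "norm2_vec (M *\<^sub>v ((1 / c) \<cdot>\<^sub>v x)) \<le> norm2_mat M"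
    unfolding norm2_mat_def
    using assms c by (intro cSUP_upper[OF _ bdd_above_norm2_mat]) (auto simp: norm2_vec_smult c_def)
  also have "M *\<^sub>v ((1 / c) \<cdot>\<^sub>v x) = (1 / c) \<cdot>\<^sub>v (M *\<^sub>v x)"
    using assms by (intro mult_mat_vec[of _ "dim_row M" "dim_col M"]) auto
  finally show ?thesis
    using c by (simp add: norm2_vec_smult c_def field_simps)
qed

text \<open>Moving one transpose across the inner product produces
  \<open>U * transpose_mat U\<close>, the identity.\<close>

lemma norm2_vec_orthogonal_matrix:
  assumes "orthogonal_matrix d U" and "x \<in> carrier_vec d"
  shows "norm2_vec (transpose_mat U *\<^sub>v x) = norm2_vec x"
proof -
  have U: "U \<in> carrier_mat d d" "U * transpose_mat U = 1\<^sub>m d"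
    using assms(1) by (auto simp: orthogonal_matrix_def)
  have "(transpose_mat U *\<^sub>v x) \<bullet> (transpose_mat U *\<^sub>v x) = x \<bullet> (U *\<^sub>v (transpose_mat U *\<^sub>v x))"
    using U assms(2) by (intro transpose_vec_mult_scalar) auto
  also have "U *\<^sub>v (transpose_mat U *\<^sub>v x) = (U * transpose_mat U) *\<^sub>v x"
    using U assms(2) by (intro assoc_mult_mat_vec[symmetric]) auto
  also have "\<dots> = x"
    using U assms(2) by simp
  finally show ?thesis
    by (simp add: norm2_vec_def)
qed

section \<open>Parseval's identity\<close>

text \<open>Dominated by the sum of the two squares, each integrable against the nonnegative
  density. This licenses the exchange of sum and integral in Parseval's identity.\<close>

lemma integrable_L2_mult:
  assumes "is_prob_density P \<rho>" and "f \<in> L2_fun P \<rho>" and "g \<in> L2_fun P \<rho>"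
  shows "integrable (lebesgue_on P) (\<lambda>p. f p * g p * \<rho> p)"
proof (rule Bochner_Integration.integrable_bound)
  show "integrable (lebesgue_on P) (\<lambda>p. (f p)\<^sup>2 * \<rho> p + (g p)\<^sup>2 * \<rho> p)"
    using assms by (auto simp: L2_fun_def expectation_exists_def)
  have "\<rho> \<in> borel_measurable (lebesgue_on P)"
    using assms(1) by (auto simp: is_prob_density_def has_bochner_integral_iff)
  then show "(\<lambda>p. f p * g p * \<rho> p) \<in> borel_measurable (lebesgue_on P)"
    using assms(2,3) by (auto simp: L2_fun_def)
  show "AE p in lebesgue_on P. norm (f p * g p * \<rho> p) \<le> norm ((f p)\<^sup>2 * \<rho> p + (g p)\<^sup>2 * \<rho> p)"
  proof (rule AE_I2)
    fix p assume "p \<in> space (lebesgue_on P)"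
    then have \<rho>: "0 \<le> \<rho> p"
      using assms(1) by (auto simp: is_prob_density_def)
    have "2 * \<bar>f p * g p\<bar> \<le> (f p)\<^sup>2 + (g p)\<^sup>2"
      using sum_squares_bound[of "\<bar>f p\<bar>" "\<bar>g p\<bar>"] by (simp add: abs_mult)
    then have "\<bar>f p * g p\<bar> \<le> (f p)\<^sup>2 + (g p)\<^sup>2"
      using abs_ge_zero[of "f p * g p"] by linarith
    then have "\<bar>f p * g p\<bar> * \<rho> p \<le> ((f p)\<^sup>2 + (g p)\<^sup>2) * \<rho> p"
      using \<rho> by (rule mult_right_mono)
    then show "norm (f p * g p * \<rho> p) \<le> norm ((f p)\<^sup>2 * \<rho> p + (g p)\<^sup>2 * \<rho> p)"
      using \<rho> by (simp add: abs_mult distrib_right)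
  qed
qed

text \<open>The square expands into a double sum of inner products of basis functions, and
  orthonormality leaves only the diagonal.\<close>

lemma L2_norm_basis_comb:
  assumes \<rho>: "is_prob_density P \<rho>" and \<Phi>: "complete_orthonormal_system P \<rho> \<Phi>"
  shows "L2_norm P \<rho> (basis_comb \<Phi> c) = norm2_vec c"
proof -
  let ?I = "{..<dim_vec c}"
  have int: "integrable (lebesgue_on P) (\<lambda>p. \<Phi> i p * \<Phi> j p * \<rho> p)" for i j
    using \<Phi> by (intro integrable_L2_mult[OF \<rho>]) (auto simp: complete_orthonormal_system_def)
  have "L2_inner P \<rho> (basis_comb \<Phi> c) (basis_comb \<Phi> c)
      = (\<integral>p. (\<Sum>i\<in>?I. \<Sum>j\<in>?I. c $ i * c $ j * (\<Phi> i p * \<Phi> j p * \<rho> p)) \<partial>(lebesgue_on P))"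
    unfolding L2_inner_def expectation_def basis_comb_def sum_product
    unfolding sum_distrib_right
    by (intro Bochner_Integration.integral_cong refl sum.cong) (simp only: mult_ac)
  also have "\<dots> = (\<Sum>i\<in>?I. \<Sum>j\<in>?I. c $ i * c $ j * (\<integral>p. \<Phi> i p * \<Phi> j p * \<rho> p \<partial>(lebesgue_on P)))"
    using int by (subst Bochner_Integration.integral_sum; simp)+
  also have "\<dots> = (\<Sum>i\<in>?I. \<Sum>j\<in>?I. c $ i * c $ j * (if i = j then 1 else 0))"
    using \<Phi> unfolding complete_orthonormal_system_def L2_inner_def expectation_def by simp
  also have "\<dots> = c \<bullet> c"
    by (simp add: scalar_prod_def atLeast0LessThan if_distrib sum.delta cong: if_cong)
  finally show ?thesis
    by (simp add: L2_norm_def norm2_vec_def)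
qed

lemma basis_comb_minus:
  assumes "dim_vec c = dim_vec d"
  shows "basis_comb \<Phi> c p - basis_comb \<Phi> d p = basis_comb \<Phi> (c - d) p"
  using assms by (simp add: basis_comb_def left_diff_distrib sum_subtractf)

text \<open>Interchange of two finite sums. With \<open>M\<close> the reduced output matrix it turns
  combinations of the \<Psi> into combinations of the \<Phi>, where Parseval applies.\<close>

lemma basis_comb_mult_mat_vec:
  assumes "dim_vec w = dim_col M" and "\<forall>j<dim_col M. \<Psi> j = basis_comb \<Phi> (col M j)"
  shows "basis_comb \<Psi> w p = basis_comb \<Phi> (M *\<^sub>v w) p"
proof -
  have "basis_comb \<Psi> w p = (\<Sum>j<dim_col M. \<Sum>i<dim_row M. w $ j * (M $$ (i, j) * \<Phi> i p))"
    using assms by (simp add: basis_comb_def sum_distrib_left)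
  also have "\<dots> = (\<Sum>i<dim_row M. \<Sum>j<dim_col M. w $ j * (M $$ (i, j) * \<Phi> i p))"
    by (rule sum.swap)
  also have "\<dots> = basis_comb \<Phi> (M *\<^sub>v w) p"
    using assms(1)
    by (auto simp: basis_comb_def scalar_prod_def atLeast0LessThan sum_distrib_right
        intro!: sum.cong)
  finally show ?thesis .
qed

section \<open>Increments of differentiable curves\<close>

lemma norminf_vec_ge: "i < dim_vec x \<Longrightarrow> \<bar>x $ i\<bar> \<le> norminf_vec x"
  unfolding norminf_vec_def by (intro Max_ge) auto

text \<open>Each component of the derivative is continuous on a compact interval, hence bounded; the
  largest of these finitely many bounds works for the maximum norm.\<close>

lemma C1_with_deriv_bdd_above:
  assumes "C1_with_deriv d a b v v'" and "0 < d"
  shows "bdd_above ((\<lambda>\<tau>. norminf_vec (v' \<tau>)) ` {a..b})"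
proof -
  have "\<exists>K. \<forall>\<tau>\<in>{a..b}. \<bar>v' \<tau> $ i\<bar> \<le> K" if "i < d" for i
  proof -
    have "continuous_on {a..b} (\<lambda>\<tau>. v' \<tau> $ i)"
      using assms(1) that by (auto simp: C1_with_deriv_def)
    then have "bounded ((\<lambda>\<tau>. v' \<tau> $ i) ` {a..b})"
      by (intro compact_imp_bounded compact_continuous_image) auto
    then show ?thesis
      by (auto simp: bounded_iff)
  qed
  then obtain K where K: "\<bar>v' \<tau> $ i\<bar> \<le> K i" if "i < d" "\<tau> \<in> {a..b}" for i \<tau>
    by metis
  show ?thesis
  proof (rule bdd_aboveI2)
    fix \<tau> assume \<tau>: "\<tau> \<in> {a..b}"
    then have dim: "dim_vec (v' \<tau>) = d"
      using assms(1) by (auto simp: C1_with_deriv_def)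
    show "norminf_vec (v' \<tau>) \<le> Max (K ` {..<d})"
      unfolding norminf_vec_def dim
      using assms(2) K[OF _ \<tau>] by (auto intro!: Max.boundedI intro: order_trans[OF _ Max_ge])
  qed
qed

text \<open>The mean value inequality holds for each component with the same constant; passing from
  the maximum to the Euclidean norm costs the square root of the dimension.\<close>

lemma norm2_vec_increment_le:
  assumes C1: "C1_with_deriv d a b v v'" and "0 < d" and s: "s \<in> {a..b}" and t: "t \<in> {a..b}"
  shows "norm2_vec (v t - v s)
    \<le> sqrt (real d) * (\<bar>t - s\<bar> * (SUP \<tau>\<in>{a..b}. norminf_vec (v' \<tau>)))" (is "_ \<le> _ * (_ * ?K)")
proof -
  have dim: "dim_vec (v \<tau>) = d" "dim_vec (v' \<tau>) = d" if "\<tau> \<in> {a..b}" for \<tau>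
    using C1 that by (auto simp: C1_with_deriv_def)
  have K: "\<bar>v' \<tau> $ i\<bar> \<le> ?K" if "\<tau> \<in> {a..b}" "i < d" for \<tau> i
    using norminf_vec_ge[of i "v' \<tau>"] cSUP_upper[OF that(1) C1_with_deriv_bdd_above[OF C1 \<open>0 < d\<close>]]
      dim that by simp
  have "0 \<le> ?K"
    using K[OF s \<open>0 < d\<close>] by linarith
  have "norm (v t $ i - v s $ i) \<le> ?K * norm (t - s)" if "i < d" for i
    using C1 that K s t
    by (intro field_differentiable_bound[where S = "{a..b}" and f' = "\<lambda>\<tau>. v' \<tau> $ i"])
      (auto simp: C1_with_deriv_def)
  then have "norm2_vec (v t - v s) \<le> sqrt (real (dim_vec (v t - v s))) * (\<bar>t - s\<bar> * ?K)"
    using dim s t \<open>0 \<le> ?K\<close> by (intro norm2_vec_le_sqrt_dim) (auto simp: mult.commute)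
  then show ?thesis
    using dim[OF s] by simp
qed

text \<open>Induction on the number of subintervals: either \<open>t\<close> lies in the last one,
  or it is at most \<open>ts k\<close> and the induction hypothesis applies.\<close>

lemma subinterval_exists:
  fixes ts :: "nat \<Rightarrow> 'a::linorder"
  assumes "ts 0 \<le> t" and "t \<le> ts k" and "0 < k"
  shows "\<exists>j<k. ts j \<le> t \<and> t \<le> ts (Suc j)"
  using assms
proof (induction k)
  case (Suc k)
  show ?case
  proof (cases "ts k \<le> t")
    case True
    then show ?thesis using Suc.prems by blast
  next
    case False
    then have "0 < k"
      using Suc.prems(1) by (cases k) auto
    then show ?thesis
      using False Suc.IH Suc.prems(1) by (meson less_SucI linear)
  qed
qed simp

section \<open>Projection error of the snapshots\<close>

lemma pod_mat_carrier: "pod_mat d U r \<in> carrier_mat d r"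
  by (rule carrier_matI) (simp_all add: pod_mat_def)

text \<open>In the basis of left singular vectors the snapshot has the coordinates
  \<open>\<sigma> i * Q $$ (j, i)\<close>. The projection deletes those with \<open>i < r\<close>;
  the rest carry a factor of at most \<open>\<sigma> r\<close>, and row \<open>j\<close> of
  \<open>Q\<close> is a unit vector.\<close>

lemma pod_projection_error:
  assumes svd: "is_svd d l V U \<sigma> Q" and "r < l" and "l \<le> d" and "j < l"
  shows "norm2_vec (col V j - pod_mat d U r *\<^sub>v (transpose_mat (pod_mat d U r) *\<^sub>v col V j)) \<le> \<sigma> r"
    (is "norm2_vec (?x - ?T *\<^sub>v (_ *\<^sub>v _)) \<le> _")
proof -
  let ?S = "mat d l (\<lambda>(i, j). if i = j then \<sigma> i else 0)"
  let ?UT = "transpose_mat U"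
  have U: "U \<in> carrier_mat d d" "?UT * U = 1\<^sub>m d" "orthogonal_matrix d U"
    and Q: "Q \<in> carrier_mat l l" "orthogonal_matrix l Q"
    and V: "V = U * ?S * transpose_mat Q"
    using svd by (auto simp: is_svd_def orthogonal_matrix_def)
  have \<sigma>: "\<sigma> i \<le> \<sigma> r" "0 \<le> \<sigma> i" if "r \<le> i" "i < l" for i
    using svd that by (auto simp: is_svd_def)
  have V_dim: "V \<in> carrier_mat d l"
    using U(1) Q(1) by (auto simp: V)
  have T_dim: "?T \<in> carrier_mat d r"
    by (rule pod_mat_carrier)
  have colT: "col ?T k = col U k" if "k < r" for k
    using that U(1) assms(2,3) unfolding pod_mat_def by (subst col_mat_of_cols) auto
  have "?UT * V = (?UT * U) * (?S * transpose_mat Q)"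
  proof -
    have "V = U * (?S * transpose_mat Q)"
      unfolding V using U(1) Q(1) by (intro assoc_mult_mat[of _ d d _ l _ l]) auto
    then show ?thesis
      using U(1) Q(1)
      by (simp only:) (intro assoc_mult_mat[of _ d d _ d _ l, symmetric], auto)
  qed
  then have UTV: "?UT * V = ?S * transpose_mat Q"
    using U(2) Q(1) by simp
  \<comment> \<open>The coordinates with \<open>l \<le> i\<close> vanish because of the zero block
    below the diagonal of singular values.\<close>
  have coord: "col U i \<bullet> ?x = (if i < l then \<sigma> i * Q $$ (j, i) else 0)" if "i < d" for i
  proof -
    have "col U i \<bullet> ?x = (?UT * V) $$ (i, j)"
      using that U(1) V_dim \<open>j < l\<close> by simp
    also have "\<dots> = (\<Sum>k<l. (if i = k then \<sigma> i else 0) * Q $$ (j, k))"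
      unfolding UTV using that Q(1) \<open>j < l\<close> by (simp add: scalar_prod_def atLeast0LessThan)
    also have "\<dots> = (if i < l then \<sigma> i * Q $$ (j, i) else 0)"
      by (simp add: if_distribR if_distrib sum.delta cong: if_cong)
    finally show ?thesis .
  qed
  have UU: "col U i \<bullet> col U k = (if i = k then 1 else 0)" if "i < d" "k < d" for i k
  proof -
    have "col U i \<bullet> col U k = (?UT * U) $$ (i, k)"
      using that U(1) by simp
    then show ?thesis using U(2) that by simp
  qed
  define z where "z = transpose_mat ?T *\<^sub>v ?x"
  define e where "e = ?x - ?T *\<^sub>v z"
  have x_dim: "?x \<in> carrier_vec d" and z_dim: "z \<in> carrier_vec r"
    using V_dim T_dim by (auto simp: z_def)
  have e_dim: "e \<in> carrier_vec d"
    using x_dim T_dim z_dim by (auto simp: e_def)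
  have z: "z $ k = col U k \<bullet> ?x" if "k < r" for k
    using that T_dim colT by (simp add: z_def)
  \<comment> \<open>By orthonormality of the columns of \<open>U\<close>, the projected vector
    agrees with the snapshot in the first \<open>r\<close> coordinates and is zero in the others, so
    only the tail of the snapshot survives in \<open>e\<close>.\<close>
  have e_coord: "(?UT *\<^sub>v e) $ i = (if r \<le> i \<and> i < l then \<sigma> i * Q $$ (j, i) else 0)" if "i < d" for i
  proof -
    have colUi: "col U i \<in> carrier_vec d"
      using U(1) by auto
    have "col U i \<bullet> (?T *\<^sub>v z) = (transpose_mat ?T *\<^sub>v col U i) \<bullet> z"
      using T_dim colUi z_dim by (intro transpose_vec_mult_scalar[symmetric]) auto
    also have "\<dots> = (\<Sum>k<r. (col U k \<bullet> col U i) * z $ k)"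
      using T_dim z_dim colT by (simp add: scalar_prod_def[of _ z] atLeast0LessThan)
    also have "\<dots> = (\<Sum>k<r. if k = i then z $ k else 0)"
      using UU that assms(2,3) by (intro sum.cong) auto
    also have "\<dots> = (if i < r then col U i \<bullet> ?x else 0)"
      using z by simp
    finally have "col U i \<bullet> e = col U i \<bullet> ?x - (if i < r then col U i \<bullet> ?x else 0)"
      unfolding e_def using colUi x_dim T_dim z_dim
      by (subst scalar_prod_minus_distrib[of _ d]) auto
    then show ?thesis
      using that U(1) coord[OF that] assms(2) by auto
  qed
  have rowQ: "norm2_vec (row Q j) = 1"
  proof -
    have "row Q j \<bullet> row Q j = (Q * transpose_mat Q) $$ (j, j)"
      using Q(1) \<open>j < l\<close> by simp
    also have "\<dots> = 1"
      using Q(2) \<open>j < l\<close> by (simp add: orthogonal_matrix_def)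
    finally show ?thesis by (simp add: norm2_vec_def)
  qed
  have "norm2_vec e = norm2_vec (?UT *\<^sub>v e)"
    using norm2_vec_orthogonal_matrix[OF U(3) e_dim] by simp
  also have "\<dots> = L2_set (\<lambda>i. if r \<le> i \<and> i < l then \<sigma> i * Q $$ (j, i) else 0) {..<d}"
    using U(1) e_coord by (auto simp: norm2_vec_eq_L2_set intro!: L2_set_cong simp del: index_mult_mat_vec)
  \<comment> \<open>Dropping the zero coordinates from \<open>l\<close> to \<open>d\<close> leaves a
    vector indexed like a row of \<open>Q\<close>.\<close>
  also have "\<dots> = L2_set (\<lambda>i. if r \<le> i then \<sigma> i * Q $$ (j, i) else 0) {..<l}"
    unfolding L2_set_def using assms(3)
    by (intro arg_cong[where f = sqrt] sum.mono_neutral_cong_right) auto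
  \<comment> \<open>For \<open>r \<le> i\<close> the ordering of the singular values gives
    \<open>\<sigma> i \<le> \<sigma> r\<close>; for \<open>i < r\<close> a zero is replaced by an
    entry of \<open>\<sigma> r\<close> times the row, which only enlarges the norm.\<close>
  also have "\<dots> \<le> norm2_vec (\<sigma> r \<cdot>\<^sub>v row Q j)"
    unfolding norm2_vec_eq_L2_set L2_set_def
    using Q(1) \<sigma> \<open>j < l\<close>
    by (auto intro!: sum_mono power_mono mult_right_mono simp: power_mult_distrib)
  also have "\<dots> = \<sigma> r"
    using \<sigma>[of r] \<open>r < l\<close> by (simp add: norm2_vec_smult rowQ)
  finally show ?thesis
    by (simp add: e_def z_def)
qed

section \<open>Error bound from the projection error and the increment between snapshots\<close>

theorem theorem2:
  fixes P :: "'q::euclidean_space set" and \<rho> :: "'q \<Rightarrow> real"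
    and \<Phi> \<Psi> :: "nat \<Rightarrow> 'q \<Rightarrow> real"
    and m n l r :: nat
    and E A B C :: "'q \<Rightarrow> real mat" and F :: "real vec \<Rightarrow> 'q \<Rightarrow> real vec"
    and u :: "real \<Rightarrow> real" and t0 tend \<Delta>t :: real
    and v0 :: "real vec" and v v' what wstar :: "real \<Rightarrow> real vec"
    and yhat ystar :: "real \<Rightarrow> 'q \<Rightarrow> real"
    and ts \<sigma> :: "nat \<Rightarrow> real"
    and Chat V U Q Tr Cbar :: "real mat"
  assumes "is_prob_density P \<rho>"
    and "complete_orthonormal_system P \<rho> \<Phi>"
    and "\<forall>p\<in>P. \<Phi> 0 p = 1"
    and "1 \<le> m" and "1 \<le> n"
    and "parametric_system P n E A B C F"
    and "sg_well_defined P \<rho> \<Phi> m n E A B C F"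
    and "sg_solution P \<rho> \<Phi> m n E A B F u t0 tend v0 v v'"
    and "Chat = sg_output P \<rho> \<Phi> m n C"
    and "\<forall>t\<in>{t0..tend}. what t = Chat *\<^sub>v v t"
    and "\<forall>t\<in>{t0..tend}. yhat t = basis_comb \<Phi> (what t)"
    and "1 \<le> r" and "r < l" and "l \<le> m * n"
    and "ts 0 = t0" and "ts (l - 1) = tend"
    and "\<forall>j<l - 1. ts j < ts (Suc j)"
    and "V = snapshot_mat (m * n) l v ts"
    and "is_svd (m * n) l V U \<sigma> Q"
    and "Tr = pod_mat (m * n) U r"
    and "Cbar = Chat * Tr"
    and "\<forall>j<r. \<Psi> j = basis_comb \<Phi> (col Cbar j)"
    and "\<forall>t\<in>{t0..tend}. is_best_approx P \<rho> r \<Psi> (yhat t) (wstar t)"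
    and "\<forall>t\<in>{t0..tend}. ystar t = basis_comb \<Psi> (wstar t)"
    and "\<Delta>t = Max ((\<lambda>j. ts (Suc j) - ts j) ` {..<l - 1})"
  shows "\<forall>t\<in>{t0..tend}.
    L2_norm P \<rho> (\<lambda>p. yhat t p - ystar t p)
      \<le> norm2_mat Chat *
         (\<sigma> r + sqrt (real (m * n)) * \<Delta>t * (SUP \<tau>\<in>{t0..tend}. norminf_vec (v' \<tau>)))"
proof
  fix t assume t: "t \<in> {t0..tend}"
  let ?d = "m * n"
  let ?K = "SUP \<tau>\<in>{t0..tend}. norminf_vec (v' \<tau>)"
  have d: "0 < ?d"
    using assms(4,5) by simp
  have C1: "C1_with_deriv ?d t0 tend v v'"
    using assms(8) by (simp add: sg_solution_def)
  have ts_mono: "ts i \<le> ts j" if "i \<le> j" "j \<le> l - 1" for i j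
    using that
  proof (induction j rule: dec_induct)
    case (step k)
    then have "ts i \<le> ts k" and "ts k < ts (Suc k)"
      using assms(17) by auto
    then show ?case by simp
  qed simp
  \<comment> \<open>There are at least two snapshots since \<open>1 \<le> r\<close> and
    \<open>r < l\<close>; the bound \<open>j < l - 1\<close> keeps both \<open>ts j\<close> and
    \<open>ts (Suc j)\<close> among the snapshot times.\<close>
  obtain j where j: "j < l - 1" "ts j \<le> t" "t \<le> ts (Suc j)"
    using subinterval_exists[of ts t "l - 1"] t assms(12,13,15,16) by auto
  have tsj: "ts j \<in> {t0..tend}"
    using j ts_mono[of 0 j] t assms(15) by auto
  have v_dim: "v \<tau> \<in> carrier_vec ?d" if "\<tau> \<in> {t0..tend}" for \<tau>
    using C1 that by (simp add: C1_with_deriv_def)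
  define x where "x = v (ts j)"
  define z where "z = transpose_mat Tr *\<^sub>v x"
  have mats: "Chat \<in> carrier_mat m ?d" "Tr \<in> carrier_mat ?d r"
    by (simp_all add: assms(9,20) sg_output_def expectation_mat_def pod_mat_carrier)
  have vecs: "v t \<in> carrier_vec ?d" "x \<in> carrier_vec ?d"
    using v_dim t tsj by (auto simp: x_def)
  have "Cbar \<in> carrier_mat m r" "z \<in> carrier_vec r"
    using mats vecs by (auto simp: assms(21) z_def)
  note dims = mats vecs this
  have colV: "col V j = x"
    using j(1) v_dim[OF tsj] unfolding assms(18) snapshot_mat_def x_def
    by (subst col_mat_of_cols) auto
  have proj: "norm2_vec (x - Tr *\<^sub>v z) \<le> \<sigma> r"
    using pod_projection_error[OF assms(19,13,14), of j] j(1) by (simp add: colV z_def assms(20))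
  \<comment> \<open>The time \<open>t\<close> shows that the supremum is over a nonempty set, and
    component 0 exists because the dimension is positive.\<close>
  have K: "0 \<le> ?K"
  proof -
    have "0 \<le> \<bar>v' t $ 0\<bar>" by simp
    also have "\<dots> \<le> norminf_vec (v' t)"
    proof (rule norminf_vec_ge)
      have "v' t \<in> carrier_vec ?d"
        using C1 t by (simp add: C1_with_deriv_def)
      then show "0 < dim_vec (v' t)"
        using d by auto
    qed
    also have "\<dots> \<le> ?K"
      by (rule cSUP_upper[OF t C1_with_deriv_bdd_above[OF C1 d]])
    finally show ?thesis .
  qed
  have "ts (Suc j) - ts j \<le> \<Delta>t"
    unfolding assms(25) using j(1) by (intro Max_ge) auto
  then have "\<bar>t - ts j\<bar> * ?K \<le> \<Delta>t * ?K"
    using j(2,3) K by (intro mult_right_mono) auto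
  then have "sqrt (real ?d) * (\<bar>t - ts j\<bar> * ?K) \<le> sqrt (real ?d) * (\<Delta>t * ?K)"
    by (rule mult_left_mono) simp
  then have incr: "norm2_vec (v t - x) \<le> sqrt (real ?d) * \<Delta>t * ?K"
    using norm2_vec_increment_le[OF C1 d tsj t] by (simp add: x_def mult.assoc)
  \<comment> \<open>Each \<Psi> has a column of \<open>Chat * Tr\<close> as its coefficients in the
    \<Phi>, so both terms are combinations of the \<Phi> and linearity merges them into one
    coefficient vector.\<close>
  have comp: "yhat t p - basis_comb \<Psi> z p = basis_comb \<Phi> (Chat *\<^sub>v (v t - Tr *\<^sub>v z)) p" for p
  proof -
    have "basis_comb \<Psi> z p = basis_comb \<Phi> (Cbar *\<^sub>v z) p"
      using dims assms(22) by (intro basis_comb_mult_mat_vec) auto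
    moreover have "yhat t p = basis_comb \<Phi> (Chat *\<^sub>v v t) p"
      using assms(10,11) t by simp
    moreover have "Cbar *\<^sub>v z = Chat *\<^sub>v (Tr *\<^sub>v z)"
      unfolding assms(21) using dims by (intro assoc_mult_mat_vec) auto
    moreover have "Chat *\<^sub>v (v t - Tr *\<^sub>v z) = Chat *\<^sub>v v t - Chat *\<^sub>v (Tr *\<^sub>v z)"
      using dims by (intro mult_minus_distrib_mat_vec) auto
    ultimately show ?thesis
      by (simp add: basis_comb_minus)
  qed
  \<comment> \<open>Minimality of \<open>wstar t\<close>, with \<open>z\<close> admissible because
    its dimension is \<open>r\<close>.\<close>
  have "L2_norm P \<rho> (\<lambda>p. yhat t p - ystar t p) \<le> L2_norm P \<rho> (\<lambda>p. yhat t p - basis_comb \<Psi> z p)"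
    using assms(23,24) t dims by (simp add: is_best_approx_def)
  also have "\<dots> = norm2_vec (Chat *\<^sub>v (v t - Tr *\<^sub>v z))"
    unfolding comp by (rule L2_norm_basis_comb[OF assms(1,2)])
  also have "\<dots> \<le> norm2_mat Chat * norm2_vec (v t - Tr *\<^sub>v z)"
    using dims by (intro norm2_mult_mat_vec_le) auto
  also have "v t - Tr *\<^sub>v z = (x - Tr *\<^sub>v z) + (v t - x)"
    using dims by (intro eq_vecI) auto
  also have "norm2_vec \<dots> \<le> \<sigma> r + sqrt (real ?d) * \<Delta>t * ?K"
    using norm2_vec_add_le[of "x - Tr *\<^sub>v z" "v t - x"] proj incr dims by simp
  finally show "L2_norm P \<rho> (\<lambda>p. yhat t p - ystar t p)
      \<le> norm2_mat Chat * (\<sigma> r + sqrt (real ?d) * \<Delta>t * ?K)"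
    by (simp add: mult_left_mono norm2_mat_nonneg)
qed

end
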